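(* Let $z=(z_j)_{j=1}^\infty$ be an element of $\ell_\infty$. The point $z$ can be separated from the closed unit ball $\overline{B_{\ell_\infty}}$ by a $\mathcal{G}_f$-invariant continuous polynomial if and only if $\limsup_{j\to\infty}|z_j|>1$.
   Context: $\ell_\infty$ is the complex Banach space of bounded sequences with the supremum norm. A permutation $\sigma$ of $\mathbb{N}$ is a finite bijection if there is $n\in\mathbb{N}$ such that the restriction of $\sigma$ to $\{n,n+1,\ldots\}$ is the identity; $\mathcal{G}_f$ is the group of all finite bijections of $\mathbb{N}$. A (complex-valued) polynomial $P$ on $\ell_\infty$ is $\mathcal{G}_f$-invariant if $P((x_{\sigma(j)})_j)=P((x_j)_j)$ for every $\sigma\in\mathcal{G}_f$ and $(x_j)_j\in\ell_\infty$. A polynomial $P$ separates a point $z$ and a set $K$ if $\sup_{w\in K}|P(w)|<|P(z)|$. *)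

theory Defs
  imports "HOL-Analysis.Analysis"
begin

text \<open>Every function on the discrete space \<open>nat\<close> is continuous, so \<open>nat \<Rightarrow>\<^sub>C complex\<close> consists
  of all bounded complex sequences, and its library norm is the supremum norm.\<close>

type_synonym linf = "nat \<Rightarrow>\<^sub>C complex"

lemma mem_bcontfun_nat_iff: "x \<in> bcontfun \<longleftrightarrow> bounded (range x)"
  for x :: "nat \<Rightarrow> complex"
  by (simp add: bcontfun_def)

context
  includes bcontfun.lifting
begin

text \<open>The library provides the real normed space structure of \<open>nat \<Rightarrow>\<^sub>C complex\<close> only; this is
  the complex one.\<close>

lift_definition scale_linf :: "complex \<Rightarrow> linf \<Rightarrow> linf"
  is "\<lambda>c x j. c * x j"
  by (force simp: mem_bcontfun_nat_iff bounded_iff norm_mult intro: mult_left_mono)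

lemma norm_linf_eq: "norm x = (SUP j. norm (apply_bcontfun x j))" for x :: linf
  by (simp add: norm_bcontfun_def dist_bcontfun_def)

lemma vector_space_linf: "vector_space scale_linf"
  by unfold_locales (auto intro!: bcontfun_eqI simp: scale_linf.rep_eq algebra_simps)

lift_definition reindex_linf :: "(nat \<Rightarrow> nat) \<Rightarrow> linf \<Rightarrow> linf"
  is "\<lambda>\<sigma> x j. x (\<sigma> j)"
  by (auto simp: mem_bcontfun_nat_iff bounded_iff)

end

definition finite_bijections :: "(nat \<Rightarrow> nat) set"
  where "finite_bijections = {\<sigma>. bij \<sigma> \<and> (\<exists>n. \<forall>j\<ge>n. \<sigma> j = j)}"

definition Gf_invariant :: "(linf \<Rightarrow> complex) \<Rightarrow> bool"
  where "Gf_invariant P \<longleftrightarrow> (\<forall>\<sigma>\<in>finite_bijections. \<forall>x. P (reindex_linf \<sigma> x) = P x)"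

text \<open>The arguments of a \<open>k\<close>-linear form are given as a list of length \<open>k\<close>; its values on lists of
  other lengths are irrelevant. No continuity is required here: continuous polynomials are the
  polynomials that are continuous as functions. For \<open>k = 0\<close> the forms are the constants.\<close>

definition multilinear_form :: "nat \<Rightarrow> (linf list \<Rightarrow> complex) \<Rightarrow> bool"
  where "multilinear_form k A \<longleftrightarrow>
    (\<forall>xs i. length xs = k \<and> i < k \<longrightarrow> Vector_Spaces.linear scale_linf (*) (\<lambda>u. A (xs[i := u])))"

definition homogeneous_polynomial :: "nat \<Rightarrow> (linf \<Rightarrow> complex) \<Rightarrow> bool"
  where "homogeneous_polynomial k Q \<longleftrightarrow>
    (\<exists>A. multilinear_form k A \<and> (\<forall>x. Q x = A (replicate k x)))"

definition polynomial_linf :: "(linf \<Rightarrow> complex) \<Rightarrow> bool"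
  where "polynomial_linf P \<longleftrightarrow>
    (\<exists>m Q. (\<forall>k\<le>m. homogeneous_polynomial k (Q k)) \<and> (\<forall>x. P x = (\<Sum>k\<le>m. Q k x)))"

text \<open>The supremum is taken in \<open>ereal\<close>, where it is \<open>\<infinity>\<close> if \<open>P\<close> is unbounded on \<open>K\<close>; the real
  \<open>Sup\<close> of an unbounded set is unspecified.\<close>

definition separates :: "(linf \<Rightarrow> complex) \<Rightarrow> linf \<Rightarrow> linf set \<Rightarrow> bool"
  where "separates P z K \<longleftrightarrow> (SUP w\<in>K. ereal (norm (P w))) < ereal (norm (P z))"

end

theory Submission
  imports Defs "HOL-Combinatorics.Permutations"
begin

text \<open>A \<open>\<G>\<^sub>f\<close>-invariant continuous polynomial does not see finite changes of its argument: if \<open>w\<close> is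
  constant on an infinite set, then adding a small \<open>c\<close> at \<open>n\<close> points of that set gives a bounded
  polynomial in \<open>n\<close>, which is constant, and such \<open>w\<close> are dense. Hence if \<open>limsup |z\<^sub>j| \<le> 1\<close>, then for
  \<open>r > 1\<close> the polynomial takes the same value at \<open>z / r\<close> and at some point of the unit ball, and
  \<open>r \<rightarrow> 1\<close> rules out separation. Conversely, a cluster point of the evaluations at coordinates
  with \<open>|z\<^sub>j| \<ge> c > 1\<close> is an invariant linear functional that separates.\<close>

section \<open>Functions with vanishing iterated differences\<close>

text \<open>Frechet's notion of a polynomial of degree at most \<open>n\<close>: all differences of
  order \<open>n + 1\<close> vanish. It makes sense between abelian groups and lets every degree
  argument run by induction through a single difference.\<close>

primrec frechet_poly :: "nat \<Rightarrow> ('a::ab_group_add \<Rightarrow> 'b::ab_group_add) \<Rightarrow> bool" where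
  "frechet_poly 0 f \<longleftrightarrow> (\<forall>x y. f x = f y)"
| "frechet_poly (Suc n) f \<longleftrightarrow> (\<forall>h. frechet_poly n (\<lambda>x. f (x + h) - f x))"

lemma frechet_poly_const: "frechet_poly n (\<lambda>_. c)"
  by (induction n arbitrary: c) auto

lemma frechet_poly_Suc: "frechet_poly n f \<Longrightarrow> frechet_poly (Suc n) f"
proof (induction n arbitrary: f)
  case 0
  then have "f (x + h) - f x = 0" for x h
    by (metis cancel_comm_monoid_add_class.diff_cancel frechet_poly.simps(1))
  then show ?case by simp
next
  case (Suc n)
  then have "frechet_poly (Suc n) (\<lambda>x. f (x + h) - f x)" for h
    by (metis frechet_poly.simps(2))
  then show ?case by (subst frechet_poly.simps) blast
qed

lemma frechet_poly_mono: "frechet_poly m f \<Longrightarrow> m \<le> n \<Longrightarrow> frechet_poly n f"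
  by (induction n) (auto simp: le_Suc_eq frechet_poly_Suc simp del: frechet_poly.simps)

lemma frechet_poly_add:
  "frechet_poly n f \<Longrightarrow> frechet_poly n g \<Longrightarrow> frechet_poly n (\<lambda>x. f x + g x)"
proof (induction n arbitrary: f g)
  case 0
  then show ?case unfolding frechet_poly.simps by metis
next
  case (Suc n)
  have "frechet_poly n (\<lambda>x. (f (x + h) - f x) + (g (x + h) - g x))" for h
    using Suc by simp
  then show ?case by (simp add: algebra_simps)
qed

lemma frechet_poly_sum:
  "finite I \<Longrightarrow> (\<And>i. i \<in> I \<Longrightarrow> frechet_poly n (f i)) \<Longrightarrow> frechet_poly n (\<lambda>x. \<Sum>i\<in>I. f i x)"
  by (induction I rule: finite_induct) (simp_all add: frechet_poly_const frechet_poly_add)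

lemma frechet_poly_shift: "frechet_poly n f \<Longrightarrow> frechet_poly n (\<lambda>x. f (x + a))"
proof (induction n arbitrary: f)
  case 0
  then show ?case by (metis frechet_poly.simps(1))
next
  case (Suc n)
  have "frechet_poly n (\<lambda>x. f (x + a + h) - f (x + a))" for h
    using Suc.IH[of "\<lambda>x. f (x + h) - f x"] Suc.prems by simp
  then show ?case by (simp add: algebra_simps)
qed

text \<open>A product rule: the increment of \<open>G x x\<close> splits into
  \<open>G (x + h) h\<close>, which is a shift, and the diagonal of
  \<open>G (x + h) y - G x y\<close>. The latter has lower degree in \<open>x\<close> and is still
  additive in \<open>y\<close>, so induction applies.\<close>

lemma frechet_poly_diagonal:
  assumes "\<And>y. frechet_poly n (\<lambda>x. G x y)"
    and "\<And>x y y'. G x (y + y') = G x y + G x y'"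
  shows "frechet_poly (Suc n) (\<lambda>x. G x x)"
  using assms
proof (induction n arbitrary: G)
  case 0
  have const: "G x y = G 0 y" for x y
    using 0(1)[of y] by simp
  have "G (x + h) (x + h) - G x x = G 0 h" for x h
    using 0(2)[of 0 x h] const[of "x + h" "x + h"] const[of x x] by simp
  then show ?case by simp
next
  case (Suc n)
  have "frechet_poly (Suc n) (\<lambda>x. G (x + h) (x + h) - G x x)" for h
  proof -
    have "frechet_poly (Suc n) (\<lambda>x. G (x + h) x - G x x)"
      using Suc.prems by (intro Suc.IH[of "\<lambda>x y. G (x + h) y - G x y"]) auto
    moreover have "frechet_poly (Suc n) (\<lambda>x. G (x + h) h)"
      by (rule frechet_poly_shift[OF Suc.prems(1)])
    ultimately have "frechet_poly (Suc n) (\<lambda>x. G (x + h) h + (G (x + h) x - G x x))"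
      by (intro frechet_poly_add)
    then show ?thesis
      by (simp add: Suc.prems(2) algebra_simps del: frechet_poly.simps)
  qed
  then show ?case by (subst frechet_poly.simps) blast
qed

text \<open>The discrete form of the fact that a polynomial of degree at most \<open>m\<close> is
  determined by \<open>m + 1\<close> values.\<close>

lemma frechet_poly_const_on_ray:
  fixes f :: "'a::real_vector \<Rightarrow> 'b::ab_group_add"
  assumes "frechet_poly m f" and "\<And>k. k \<le> m \<Longrightarrow> f (x + real k *\<^sub>R h) = f x"
  shows "f (x + real n *\<^sub>R h) = f x"
  using assms
proof (induction m arbitrary: f n)
  case 0
  then show ?case by (metis frechet_poly.simps(1))
next
  case (Suc m)
  define g where "g y = f (y + h) - f y" for y
  have step: "g (x + real k *\<^sub>R h) = f (x + real (Suc k) *\<^sub>R h) - f (x + real k *\<^sub>R h)" for k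
    by (simp add: g_def algebra_simps)
  \<comment> \<open>The \<open>m + 2\<close> equal values of \<open>f\<close> yield
    \<open>m + 1\<close> zeros of its difference \<open>g\<close>.\<close>
  have g0: "g (x + real k *\<^sub>R h) = 0" if "k \<le> m" for k
    using that Suc.prems(2)[of k] Suc.prems(2)[of "Suc k"] by (simp only: step) simp
  have "g (x + real k *\<^sub>R h) = g x" for k
  proof (rule Suc.IH)
    show "frechet_poly m g"
      using Suc.prems(1) unfolding g_def by simp
    show "g (x + real k *\<^sub>R h) = g x" if "k \<le> m" for k
      using g0[of 0] g0[OF that] by simp
  qed
  moreover have "g x = 0" using g0[of 0] by simp
  ultimately have "f (x + real (Suc k) *\<^sub>R h) = f (x + real k *\<^sub>R h)" for k
    using step[of k] by simp
  then show ?case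
    by (induction n) (simp, metis)
qed

text \<open>Split off the first argument of the form: with it frozen, the rest is multilinear in one
  argument fewer, and the form is additive in it. This is the situation of
  \<open>frechet_poly_diagonal\<close>.\<close>

lemma homogeneous_polynomial_frechet:
  assumes "homogeneous_polynomial k Q"
  shows "frechet_poly k Q"
proof -
  have "frechet_poly k (\<lambda>x. A (replicate k x))" if "multilinear_form k A" for A
    using that
  proof (induction k arbitrary: A)
    case 0
    then show ?case by simp
  next
    case (Suc k)
    have lin: "Vector_Spaces.linear scale_linf (*) (\<lambda>u. A (xs[i := u]))"
      if "length xs = Suc k" "i < Suc k" for xs i
      using Suc.prems that unfolding multilinear_form_def by blast
    have "multilinear_form k (\<lambda>xs. A (y # xs))" for y
      unfolding multilinear_form_def
    proof (intro allI impI, elim conjE)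
      fix xs :: "linf list" and i
      assume "length xs = k" "i < k"
      then show "Vector_Spaces.linear scale_linf (*) (\<lambda>u. A (y # xs[i := u]))"
        using lin[of "y # xs" "Suc i"] by simp
    qed
    then have "frechet_poly k (\<lambda>x. A (y # replicate k x))" for y
      by (rule Suc.IH)
    moreover have "A ((y + y') # replicate k x) = A (y # replicate k x) + A (y' # replicate k x)"
      for x y y'
      using lin[of "y # replicate k x" 0]
      by (simp add: Vector_Spaces.linear_iff)
    ultimately have "frechet_poly (Suc k) (\<lambda>x. A (x # replicate k x))"
      by (rule frechet_poly_diagonal)
    then show ?case
      by (simp del: frechet_poly.simps)
  qed
  moreover obtain A where "multilinear_form k A" "Q = (\<lambda>x. A (replicate k x))"
    using assms unfolding homogeneous_polynomial_def by blast
  ultimately show ?thesis by simp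
qed

lemma polynomial_linf_frechet:
  assumes "polynomial_linf P"
  obtains m where "frechet_poly m P"
proof -
  obtain m Q where Q: "\<And>k. k \<le> m \<Longrightarrow> homogeneous_polynomial k (Q k)"
    and P: "\<And>x. P x = (\<Sum>k\<le>m. Q k x)"
    using assms unfolding polynomial_linf_def by blast
  have "frechet_poly m (\<lambda>x. \<Sum>k\<le>m. Q k x)"
    using frechet_poly_mono[OF homogeneous_polynomial_frechet[OF Q]]
    by (intro frechet_poly_sum) auto
  moreover have "P = (\<lambda>x. \<Sum>k\<le>m. Q k x)"
    using P by blast
  ultimately show thesis
    using that by simp
qed

section \<open>Invariant polynomials ignore finitely many coordinates\<close>

context
  includes bcontfun.lifting
begin

lift_definition mask_linf :: "nat set \<Rightarrow> linf \<Rightarrow> linf"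
  is "\<lambda>A x j. if j \<in> A then x j else 0"
proof -
  fix A :: "nat set" and x :: "nat \<Rightarrow> complex"
  assume "x \<in> bcontfun"
  then have "bounded (insert 0 (range x))"
    by (simp add: mem_bcontfun_nat_iff)
  then have "bounded (range (\<lambda>j. if j \<in> A then x j else 0))"
    by (rule bounded_subset) auto
  then show "(\<lambda>j. if j \<in> A then x j else 0) \<in> bcontfun"
    by (simp add: mem_bcontfun_nat_iff)
qed

end

lemma apply_mask_linf [simp]: "apply_bcontfun (mask_linf A x) j = (if j \<in> A then apply_bcontfun x j else 0)"
  by (simp add: mask_linf.rep_eq)

lemma apply_const_linf [simp]: "apply_bcontfun (const_bcontfun c) j = c"
  by (simp add: const_bcontfun.rep_eq)

lemma mask_linf_empty [simp]: "mask_linf {} x = 0"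
  by (auto intro!: bcontfun_eqI)

lemma mask_linf_insert: "j \<notin> A \<Longrightarrow> mask_linf (insert j A) x = mask_linf A x + mask_linf {j} x"
  by (auto intro!: bcontfun_eqI)

lemma norm_mask_linf: "norm (mask_linf A x) \<le> norm x"
  using norm_bounded[of x] by (intro norm_bound) auto

text \<open>Adding the points of \<open>S\<close> one at a time turns a bound on the degree of
  \<open>f\<close> into one on the degree of \<open>h\<close> in \<open>n\<close>, and a bounded
  polynomial sequence is constant.\<close>

lemma frechet_poly_bounded_symmetric_const:
  fixes f :: "linf \<Rightarrow> complex"
  assumes "frechet_poly m f" "infinite S" "bounded (range h)"
    and "\<And>A. finite A \<Longrightarrow> A \<subseteq> S \<Longrightarrow> f (mask_linf A u) = h (card A)"
  shows "h n = h 0"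
  using assms
proof (induction m arbitrary: f S h n)
  case 0
  obtain B where "finite B" "card B = n" "B \<subseteq> S"
    using infinite_arbitrarily_large[OF 0(2)] by blast
  then show ?case
    using 0(4)[of B] 0(4)[of "{}"] 0(1) by (metis card.empty empty_subsetI finite.emptyI frechet_poly.simps(1))
next
  case (Suc m)
  obtain s where s: "s \<in> S"
    using Suc.prems(2) by fastforce
  \<comment> \<open>On subsets of \<open>S - {s}\<close>, the difference of \<open>f\<close> in
    direction \<open>mask_linf {s} u\<close> again depends only on the cardinality, through
    \<open>d\<close>.\<close>
  define d where "d n = h (Suc n) - h n" for n
  obtain M where M: "\<And>n. norm (h n) \<le> M"
    using Suc.prems(3) by (auto simp: bounded_iff)
  have d0: "d n = d 0" for n
  proof (rule Suc.IH)
    show "frechet_poly m (\<lambda>x. f (x + mask_linf {s} u) - f x)"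
      using Suc.prems(1) by simp
    show "infinite (S - {s})"
      using Suc.prems(2) by simp
    have "norm (d n) \<le> M + M" for n
      unfolding d_def using M by (meson add_mono norm_triangle_le_diff)
    then show "bounded (range d)"
      by (auto simp: bounded_iff)
    show "f (mask_linf A u + mask_linf {s} u) - f (mask_linf A u) = d (card A)"
      if "finite A" "A \<subseteq> S - {s}" for A
    proof -
      have "s \<notin> A" "A \<subseteq> S" using that by auto
      then show ?thesis
        using Suc.prems(4)[of A] Suc.prems(4)[of "insert s A"] s that
        by (auto simp: d_def mask_linf_insert[symmetric])
    qed
  qed
  \<comment> \<open>Constant increments make \<open>h\<close> affine, and boundedness then forces
    slope zero.\<close>
  have h: "h n = h 0 + of_nat n * d 0" for n
  proof (induction n)
    case (Suc n)
    then show ?case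
      using d0[of n] by (simp add: d_def[of n] algebra_simps)
  qed simp
  have "d 0 = 0"
  proof (rule ccontr)
    assume "d 0 \<noteq> 0"
    then obtain N :: nat where N: "2 * M < real N * norm (d 0)"
      using reals_Archimedean3[of "norm (d 0)"] by auto
    have "real N * norm (d 0) = norm (h N - h 0)"
      using h[of N] by (simp add: norm_mult)
    also have "\<dots> \<le> M + M"
      using M by (meson add_mono norm_triangle_le_diff)
    finally show False using N by simp
  qed
  then show ?case using h by simp
qed

lemma exists_finite_bijection:
  assumes "finite A" "finite B" "card A = card B"
  obtains \<sigma> where "\<sigma> \<in> finite_bijections" "\<And>j. \<sigma> j \<in> B \<longleftrightarrow> j \<in> A"
    "\<And>j. j \<notin> A \<union> B \<Longrightarrow> \<sigma> j = j" "\<And>j. j \<in> A \<union> B \<Longrightarrow> \<sigma> j \<in> A \<union> B"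
proof -
  obtain f where f: "bij_betw f A B"
    using assms finite_same_card_bij by blast
  \<comment> \<open>\<open>A\<close> and \<open>B\<close> may overlap. Once \<open>f\<close> carries
    \<open>A\<close> onto \<open>B\<close>, the points of \<open>B - A\<close> still need images,
    and \<open>A - B\<close> offers equally many.\<close>
  have "card (B - A) = card (A - B)"
    using assms by (metis card_Diff_subset_Int finite_Int inf_commute)
  then obtain g where g: "bij_betw g (B - A) (A - B)"
    using assms finite_same_card_bij by (metis finite_Diff)
  define \<sigma> where "\<sigma> j = (if j \<in> A then f j else if j \<in> B - A then g j else j)" for j
  have "bij_betw (\<lambda>j. if j \<in> A then f j else g j) (A \<union> (B - A)) (B \<union> (A - B))"
    by (rule bij_betw_disjoint_Un[OF f g]) auto
  then have b: "bij_betw \<sigma> (A \<union> B) (A \<union> B)"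
    by (subst bij_betw_cong[of _ _ "\<lambda>j. if j \<in> A then f j else g j"])
      (auto simp: \<sigma>_def Un_commute)
  have out: "\<sigma> j = j" if "j \<notin> A \<union> B" for j
    using that by (auto simp: \<sigma>_def)
  have "\<sigma> permutes (A \<union> B)"
    by (rule bij_imp_permutes[OF b out])
  then have "bij \<sigma>"
    by (rule permutes_bij)
  moreover obtain N where "A \<union> B \<subseteq> {..<N}"
    using assms finite_nat_bounded[of "A \<union> B"] by blast
  then have "\<forall>j\<ge>N. \<sigma> j = j"
    using out by fastforce
  ultimately have "\<sigma> \<in> finite_bijections"
    by (auto simp: finite_bijections_def)
  moreover have "\<sigma> j \<in> B \<longleftrightarrow> j \<in> A" for j
    using bij_betwE[OF f] bij_betwE[OF g] by (auto simp: \<sigma>_def)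
  ultimately show thesis
    using that out bij_betwE[OF b] by blast
qed

text \<open>A finite bijection that moves only points of \<open>S\<close> leaves \<open>w\<close>
  unchanged, because \<open>w\<close> is constant there, but can carry one perturbation to the
  other.\<close>

lemma Gf_invariant_add_mask_const:
  assumes "Gf_invariant P" and w: "\<And>j. j \<in> S \<Longrightarrow> apply_bcontfun w j = v"
    and AB: "finite A" "finite B" "A \<subseteq> S" "B \<subseteq> S" "card A = card B"
  shows "P (w + mask_linf A (const_bcontfun c)) = P (w + mask_linf B (const_bcontfun c))"
proof -
  obtain \<sigma> where \<sigma>: "\<sigma> \<in> finite_bijections" "\<And>j. \<sigma> j \<in> B \<longleftrightarrow> j \<in> A"
    "\<And>j. j \<notin> A \<union> B \<Longrightarrow> \<sigma> j = j" "\<And>j. j \<in> A \<union> B \<Longrightarrow> \<sigma> j \<in> A \<union> B"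
    using exists_finite_bijection[of A B] AB by metis
  have "apply_bcontfun w (\<sigma> j) = apply_bcontfun w j" for j
    using \<sigma>(3,4)[of j] w[of j] w[of "\<sigma> j"] AB by (cases "j \<in> A \<union> B") auto
  then have "reindex_linf \<sigma> (w + mask_linf B (const_bcontfun c)) = w + mask_linf A (const_bcontfun c)"
    by (auto intro!: bcontfun_eqI simp: reindex_linf.rep_eq \<sigma>(2))
  then show ?thesis
    using assms(1) \<sigma>(1) unfolding Gf_invariant_def by metis
qed

text \<open>Continuity at \<open>w\<close> gives boundedness only for small \<open>c\<close>; polynomiality along the ray through
  \<open>c\<close> then removes the restriction.\<close>

lemma invariant_polynomial_add_on_constant:
  assumes P: "frechet_poly m P" "continuous_on UNIV P" "Gf_invariant P"
    and w: "\<And>j. j \<in> S \<Longrightarrow> apply_bcontfun w j = v" and S: "infinite S" "s \<in> S"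
  shows "P (w + mask_linf {s} (const_bcontfun c)) = P w"
proof -
  obtain \<delta> where \<delta>: "\<delta> > 0" "\<And>x. dist x w < \<delta> \<Longrightarrow> dist (P x) (P w) < 1"
    using P(2) unfolding continuous_on_iff by (metis UNIV_I zero_less_one)
  have small: "P (w + mask_linf {s} (const_bcontfun c)) = P w" if c: "norm c < \<delta>" for c
  proof -
    obtain B where B: "\<And>n. finite (B n) \<and> card (B n) = n \<and> B n \<subseteq> S"
      using infinite_arbitrarily_large[OF S(1)] by metis
    define h where "h n = P (w + mask_linf (B n) (const_bcontfun c))" for n
    \<comment> \<open>In the supremum norm the size of the perturbation does not grow with the
      number of points. Continuity at \<open>w\<close> therefore bounds all values
      \<open>h n\<close> at once.\<close>
    have "norm (mask_linf A (const_bcontfun c)) < \<delta>" for A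
      using norm_mask_linf[of A "const_bcontfun c"] norm_bound[of "const_bcontfun c" "norm c"] c
      by (metis apply_const_linf dual_order.refl le_less_trans)
    then have "dist (h n) (P w) < 1" for n
      unfolding h_def by (intro \<delta>(2)) (simp add: dist_norm)
    then have "bounded (range h)"
      unfolding bounded_def by (metis (no_types, lifting) dist_commute imageE less_imp_le)
    moreover have h: "P (mask_linf A (const_bcontfun c) + w) = h (card A)" if "finite A" "A \<subseteq> S" for A
      unfolding h_def
      using Gf_invariant_add_mask_const[OF P(3) w, of S A "B (card A)" c] that B[of "card A"]
      by (simp add: add.commute)
    ultimately have "h 1 = h 0"
      using frechet_poly_bounded_symmetric_const[OF frechet_poly_shift[OF P(1), of w] S(1)] by blast
    then show ?thesis
      using h[of "{s}"] h[of "{}"] S(2) by (simp add: add.commute)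
  qed
  \<comment> \<open>\<open>N\<close> is so large that the multiples \<open>k * c / N\<close> with
    \<open>k \<le> m\<close> all have modulus below \<open>\<delta>\<close>; the \<open>N\<close>-th
    multiple is \<open>c\<close> itself.\<close>
  obtain N :: nat where N: "real m * norm c / \<delta> < real N"
    using reals_Archimedean2 by blast
  have "0 \<le> real m * norm c / \<delta>"
    using \<delta>(1) by simp
  then have N0: "N > 0" using N by (cases N) auto
  define u where "u = mask_linf {s} (const_bcontfun (c / of_nat N))"
  have u: "real k *\<^sub>R u = mask_linf {s} (const_bcontfun (of_nat k * c / of_nat N))" for k
    unfolding u_def by (auto intro!: bcontfun_eqI simp: scaleR_conv_of_real)
  have "P (w + real N *\<^sub>R u) = P w"
  proof (rule frechet_poly_const_on_ray[OF P(1)])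
    fix k assume "k \<le> m"
    then have "real k * norm c \<le> real m * norm c"
      by (intro mult_right_mono) auto
    also have "\<dots> < real N * \<delta>"
      using N \<delta>(1) by (simp add: field_simps)
    finally have "norm (of_nat k * c / of_nat N) < \<delta>"
      using N0 by (simp add: norm_mult norm_divide field_simps)
    then show "P (w + real k *\<^sub>R u) = P w"
      unfolding u by (rule small)
  qed
  then show ?thesis
    using N0 unfolding u by simp
qed

text \<open>If \<open>s\<close> lies outside \<open>S\<close>, first reset coordinate
  \<open>s\<close> to \<open>v\<close>. The result \<open>w0\<close> is constant on
  \<open>insert s S\<close>, and both sides are values of \<open>P\<close> at \<open>w0\<close> with
  coordinate \<open>s\<close> altered.\<close>

lemma invariant_polynomial_add_infinitely_often:
  assumes P: "frechet_poly m P" "continuous_on UNIV P" "Gf_invariant P"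
    and w: "\<And>j. j \<in> S \<Longrightarrow> apply_bcontfun w j = v" and S: "infinite S"
  shows "P (w + mask_linf {s} (const_bcontfun c)) = P w"
proof -
  define w0 where "w0 = w + mask_linf {s} (const_bcontfun (v - apply_bcontfun w s))"
  have "apply_bcontfun w0 j = v" if "j \<in> insert s S" for j
    using that w by (auto simp: w0_def)
  then have *: "P (w0 + mask_linf {s} (const_bcontfun c)) = P w0" for c
    using S by (intro invariant_polynomial_add_on_constant[OF P, of "insert s S"]) auto
  have "w + mask_linf {s} (const_bcontfun c) =
      w0 + mask_linf {s} (const_bcontfun (c + apply_bcontfun w s - v))"
    "w = w0 + mask_linf {s} (const_bcontfun (apply_bcontfun w s - v))"
    by (auto intro!: bcontfun_eqI simp: w0_def)
  then show ?thesis
    using * by metis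
qed

text \<open>By Bolzano-Weierstrass some subsequence converges to a value \<open>v\<close>;
  overwriting \<open>x\<close> by \<open>v\<close> on a tail of it costs at most
  \<open>e\<close>.\<close>

lemma approx_infinitely_often_constant:
  fixes x :: linf
  assumes "e > 0"
  obtains w v S where "infinite S" "\<And>j. j \<in> S \<Longrightarrow> apply_bcontfun w j = v" "dist w x \<le> e"
proof -
  obtain v r where r: "strict_mono (r :: nat \<Rightarrow> nat)" "((\<lambda>k. apply_bcontfun x (r k)) \<longlonglongrightarrow> v)"
    using bounded_imp_convergent_subsequence[of "apply_bcontfun x"] bounded_apply_bcontfun
    unfolding comp_def by blast
  obtain n where n: "\<And>k. k \<ge> n \<Longrightarrow> dist (apply_bcontfun x (r k)) v < e"
    using r(2) assms unfolding lim_sequentially by blast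
  define S where "S = r ` {n..}"
  define w where "w = x + mask_linf S (const_bcontfun v - x)"
  show thesis
  proof
    show "infinite S"
      unfolding S_def using r(1) infinite_Ici
      by (metis finite_imageD strict_mono_imp_inj_on inj_on_subset subset_UNIV)
    show "apply_bcontfun w j = v" if "j \<in> S" for j
      using that by (simp add: w_def)
    show "dist w x \<le> e"
    proof (rule dist_bound)
      fix j
      show "dist (apply_bcontfun w j) (apply_bcontfun x j) \<le> e"
        using n assms by (auto simp: w_def S_def dist_commute less_imp_le)
    qed
  qed
qed

text \<open>Both sides are continuous in \<open>x\<close> and agree on the dense set of sequences
  that are constant on an infinite set.\<close>

lemma invariant_polynomial_add_single:
  assumes P: "frechet_poly m P" "continuous_on UNIV P" "Gf_invariant P"
  shows "P (x + mask_linf {s} (const_bcontfun c)) = P x"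
proof -
  have "\<exists>w. dist w x \<le> inverse (real (Suc n)) \<and> P (w + mask_linf {s} (const_bcontfun c)) = P w" for n
    using approx_infinitely_often_constant[of "inverse (real (Suc n))" x]
      invariant_polynomial_add_infinitely_often[OF P]
    by (metis inverse_positive_iff_positive of_nat_0_less_iff zero_less_Suc)
  then obtain w where w: "\<And>n. dist (w n) x \<le> inverse (real (Suc n))"
    "\<And>n. P (w n + mask_linf {s} (const_bcontfun c)) = P (w n)"
    by metis
  have lim: "w \<longlonglongrightarrow> x"
    by (rule metric_tendsto_imp_tendsto[OF LIMSEQ_inverse_real_of_nat]) (use w(1) in auto)
  have cont: "isCont P y" for y
    using P(2) by (simp add: continuous_on_eq_continuous_at)
  have "(\<lambda>n. P (w n)) \<longlonglongrightarrow> P x"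
    by (rule isCont_tendsto_compose[OF cont lim])
  moreover have "(\<lambda>n. P (w n + mask_linf {s} (const_bcontfun c))) \<longlonglongrightarrow>
      P (x + mask_linf {s} (const_bcontfun c))"
    by (intro isCont_tendsto_compose[OF cont] tendsto_intros lim)
  ultimately show ?thesis
    unfolding w(2) by (metis LIMSEQ_unique)
qed

lemma invariant_polynomial_add_finite:
  assumes P: "frechet_poly m P" "continuous_on UNIV P" "Gf_invariant P" and "finite A"
  shows "P (x + mask_linf A u) = P x"
  using assms(4)
proof (induction A rule: finite_induct)
  case (insert s A)
  have "mask_linf {s} u = mask_linf {s} (const_bcontfun (apply_bcontfun u s))"
    by (auto intro!: bcontfun_eqI)
  then have "x + mask_linf (insert s A) u =
      (x + mask_linf A u) + mask_linf {s} (const_bcontfun (apply_bcontfun u s))"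
    by (metis add.assoc insert.hyps(2) mask_linf_insert)
  then show ?case
    using insert.IH invariant_polynomial_add_single[OF P] by metis
qed simp

lemma invariant_polynomial_le_SUP_ball:
  assumes P: "polynomial_linf P" "continuous_on UNIV P" "Gf_invariant P"
    and z: "limsup (\<lambda>j. ereal (norm (apply_bcontfun z j))) \<le> 1"
  shows "ereal (norm (P z)) \<le> (SUP w\<in>cball 0 1. ereal (norm (P w)))"
proof -
  obtain m where m: "frechet_poly m P"
    using polynomial_linf_frechet[OF P(1)] .
  define r where "r n = 1 + inverse (real (Suc n))" for n
  have bound: "ereal (norm (P (inverse (r n) *\<^sub>R z))) \<le> (SUP w\<in>cball 0 1. ereal (norm (P w)))" for n
  proof -
    have r: "r n > 1"
      unfolding r_def by simp
    then have "1 < ereal (r n)"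
      by simp
    then have "eventually (\<lambda>j. ereal (norm (apply_bcontfun z j)) < ereal (r n)) sequentially"
      using z unfolding Limsup_le_iff by blast
    then have fin: "finite {j. \<not> norm (apply_bcontfun z j) < r n}" (is "finite ?A")
      by (simp add: eventually_cofinite flip: cofinite_eq_sequentially)
    \<comment> \<open>\<open>y\<close> is \<open>z / r n\<close> with its finitely many coordinates
      of modulus at least 1 set to zero.\<close>
    define y where "y = inverse (r n) *\<^sub>R z + mask_linf ?A (- (inverse (r n) *\<^sub>R z))"
    have "norm y \<le> 1"
      using r by (intro norm_bound) (auto simp: y_def field_simps)
    moreover have "P y = P (inverse (r n) *\<^sub>R z)"
      unfolding y_def by (rule invariant_polynomial_add_finite[OF m P(2,3) fin])
    ultimately show ?thesis
      by (metis SUP_upper mem_cball_0)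
  qed
  \<comment> \<open>Since \<open>r n\<close> tends to 1, continuity of \<open>P\<close> carries the
    bound over to \<open>z\<close>.\<close>
  have "(\<lambda>n. inverse (r n) *\<^sub>R z) \<longlonglongrightarrow> inverse (1 + 0) *\<^sub>R z"
    unfolding r_def by (intro tendsto_intros LIMSEQ_inverse_real_of_nat) simp
  then have "(\<lambda>n. ereal (norm (P (inverse (r n) *\<^sub>R z)))) \<longlonglongrightarrow> ereal (norm (P z))"
    using P(2) by (intro tendsto_intros isCont_tendsto_compose[of _ P])
      (auto simp: continuous_on_eq_continuous_at)
  then show ?thesis
    by (rule LIMSEQ_le_const2) (use bound in auto)
qed

section \<open>Invariant functionals as cluster points of evaluations\<close>

text \<open>Tychonoff's theorem provides the cluster point, and it inherits every closed condition that
  holds for the evaluations at all large elements of \<open>S\<close>.\<close>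

lemma exists_invariant_functional:
  fixes z :: linf
  assumes S: "infinite S" "\<And>j. j \<in> S \<Longrightarrow> norm (apply_bcontfun z j) \<ge> c"
  obtains \<phi> :: "linf \<Rightarrow> complex" where
    "\<And>x y. \<phi> (x + y) = \<phi> x + \<phi> y" "\<And>a x. \<phi> (scale_linf a x) = a * \<phi> x"
    "\<And>x. norm (\<phi> x) \<le> norm x" "Gf_invariant \<phi>" "norm (\<phi> z) \<ge> c"
proof -
  define F :: "(linf \<Rightarrow> complex) filter"
    where "F = filtermap (\<lambda>j x. apply_bcontfun x j) (inf sequentially (principal S))"
  \<comment> \<open>A product of closed discs, compact in the topology of pointwise convergence; it
    contains every evaluation at a coordinate.\<close>
  define K :: "(linf \<Rightarrow> complex) set" where "K = (\<Pi>\<^sub>E x\<in>UNIV. cball 0 (norm x))"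
  \<comment> \<open>Every tail of the natural numbers meets the infinite set \<open>S\<close>, so
    \<open>F\<close> is a proper filter.\<close>
  have "frequently (\<lambda>j. j \<in> S) sequentially"
    using S(1) by (simp add: frequently_cofinite flip: cofinite_eq_sequentially)
  then have "F \<noteq> bot"
    by (simp add: F_def trivial_limit_def eventually_filtermap eventually_inf_principal frequently_def)
  have F: "eventually Q F" if "\<And>j. j \<ge> n \<Longrightarrow> j \<in> S \<Longrightarrow> Q (\<lambda>x. apply_bcontfun x j)" for Q n
    using that by (auto simp: F_def eventually_filtermap eventually_inf_principal eventually_sequentially)
  have "compactin (product_topology (\<lambda>_. euclidean) UNIV) K"
    unfolding K_def by (simp add: compactin_PiE)
  then have "compact K"
    by (simp add: euclidean_product_topology)
  moreover have "eventually (\<lambda>\<phi>. \<phi> \<in> K) F"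
    by (rule F) (simp add: K_def PiE_UNIV_domain norm_bounded)
  ultimately obtain \<phi> where \<phi>: "\<phi> \<in> K" "inf (nhds \<phi>) F \<noteq> bot"
    using \<open>F \<noteq> bot\<close> unfolding compact_filter by blast
  \<comment> \<open>If \<open>Q\<close> failed at \<open>\<phi>\<close>, it would fail on a
    neighbourhood of \<open>\<phi>\<close>, while it holds eventually along
    \<open>F\<close>.\<close>
  have closed: "Q \<phi>"
    if "closed {\<psi>. Q \<psi>}" and Q: "\<And>j. j \<ge> n \<Longrightarrow> j \<in> S \<Longrightarrow> Q (\<lambda>x. apply_bcontfun x j)" for Q n
  proof (rule ccontr)
    assume "\<not> Q \<phi>"
    then have "eventually (\<lambda>\<psi>. \<not> Q \<psi>) (nhds \<phi>)"
      using that(1) unfolding closed_def eventually_nhds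
      by (intro exI[of _ "- {\<psi>. Q \<psi>}"]) auto
    then have "eventually (\<lambda>_. False) (inf (nhds \<phi>) F)"
      using F[of n Q] Q by (auto simp: eventually_inf)
    then show False
      using \<phi>(2) by (simp add: trivial_limit_def)
  qed
  note [continuous_intros] = continuous_on_product_coordinates
  show thesis
  proof
    show "\<phi> (x + y) = \<phi> x + \<phi> y" for x y
      by (rule closed[of "\<lambda>\<psi>. \<psi> (x + y) = \<psi> x + \<psi> y"]) (auto intro!: closed_Collect_eq continuous_intros)
    show "\<phi> (scale_linf a x) = a * \<phi> x" for a x
      by (rule closed[of "\<lambda>\<psi>. \<psi> (scale_linf a x) = a * \<psi> x"])
        (auto intro!: closed_Collect_eq continuous_intros simp: scale_linf.rep_eq)
    show "norm (\<phi> x) \<le> norm x" for x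
      using \<phi>(1) by (auto simp: K_def PiE_UNIV_domain)
    show "Gf_invariant \<phi>"
      unfolding Gf_invariant_def
    proof (intro ballI allI)
      fix \<sigma> and x :: linf assume "\<sigma> \<in> finite_bijections"
      then obtain n where "\<And>j. j \<ge> n \<Longrightarrow> \<sigma> j = j"
        by (auto simp: finite_bijections_def)
      \<comment> \<open>Only evaluations at coordinates \<open>j \<ge> n\<close>, which
        \<open>\<sigma>\<close> fixes, satisfy this equation for certain; hence the threshold
        \<open>n\<close>.\<close>
      then show "\<phi> (reindex_linf \<sigma> x) = \<phi> x"
        by (intro closed[of "\<lambda>\<psi>. \<psi> (reindex_linf \<sigma> x) = \<psi> x" n])
          (auto intro!: closed_Collect_eq continuous_intros simp: reindex_linf.rep_eq)
    qed
    show "norm (\<phi> z) \<ge> c"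
      by (rule closed[of "\<lambda>\<psi>. norm (\<psi> z) \<ge> c"]) (auto intro!: closed_Collect_le continuous_intros S(2))
  qed
qed

lemma linear_functional_polynomial_linf:
  assumes "\<And>x y. \<phi> (x + y) = \<phi> x + \<phi> y" "\<And>a x. \<phi> (scale_linf a x) = a * \<phi> x"
  shows "polynomial_linf \<phi>"
proof -
  have "Vector_Spaces.linear scale_linf (*) \<phi>"
    using assms vector_space_linf vector_space_over_itself.vector_space_axioms
    by (simp add: Vector_Spaces.linear_iff)
  then have "multilinear_form 1 (\<lambda>xs. \<phi> (xs ! 0))"
    by (simp add: multilinear_form_def)
  then have "homogeneous_polynomial 1 \<phi>"
    unfolding homogeneous_polynomial_def by (intro exI[of _ "\<lambda>xs. \<phi> (xs ! 0)"]) simp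
  moreover have "homogeneous_polynomial 0 (\<lambda>_. 0)"
    unfolding homogeneous_polynomial_def multilinear_form_def by (intro exI[of _ "\<lambda>_. 0"]) simp
  ultimately show ?thesis
    unfolding polynomial_linf_def
    by (intro exI[of _ 1] exI[of _ "\<lambda>k. if k = 0 then (\<lambda>_. 0) else \<phi>"]) (auto simp: le_Suc_eq)
qed

lemma continuous_on_contractive_additive:
  fixes \<phi> :: "'a::real_normed_vector \<Rightarrow> 'b::real_normed_vector"
  assumes "\<And>x y. \<phi> (x + y) = \<phi> x + \<phi> y" "\<And>x. norm (\<phi> x) \<le> norm x"
  shows "continuous_on UNIV \<phi>"
proof -
  have "\<phi> x - \<phi> y = \<phi> (x - y)" for x y
    using assms(1)[of "x - y" y] by simp
  then have "dist (\<phi> x) (\<phi> y) \<le> dist x y" for x y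
    using assms(2)[of "x - y"] by (simp add: dist_norm)
  then show ?thesis
    unfolding continuous_on_iff by (meson le_less_trans)
qed

theorem proposition4p7:
  fixes z :: linf
  shows "(\<exists>P. polynomial_linf P \<and> continuous_on UNIV P \<and> Gf_invariant P \<and> separates P z (cball 0 1))
    \<longleftrightarrow> limsup (\<lambda>j. ereal (norm (apply_bcontfun z j))) > 1"
proof
  assume "\<exists>P. polynomial_linf P \<and> continuous_on UNIV P \<and> Gf_invariant P \<and> separates P z (cball 0 1)"
  then show "limsup (\<lambda>j. ereal (norm (apply_bcontfun z j))) > 1"
    unfolding separates_def using invariant_polynomial_le_SUP_ball by (meson leD not_le)
next
  assume "limsup (\<lambda>j. ereal (norm (apply_bcontfun z j))) > 1"
  then have "\<not> limsup (\<lambda>j. ereal (norm (apply_bcontfun z j))) \<le> 1"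
    by simp
  \<comment> \<open>A level strictly above 1 that infinitely many \<open>|z_j|\<close> reach; the
    strict gap survives in the cluster point.\<close>
  then obtain C where C: "C > 1" "\<not> eventually (\<lambda>j. ereal (norm (apply_bcontfun z j)) < C) sequentially"
    unfolding Limsup_le_iff by blast
  define S where "S = {j. C \<le> ereal (norm (apply_bcontfun z j))}"
  have S: "infinite S"
    using C(2) by (simp add: S_def eventually_cofinite not_less flip: cofinite_eq_sequentially)
  then obtain j where "j \<in> S"
    by fastforce
  \<comment> \<open>\<open>C\<close> is an extended real; a single element of \<open>S\<close> shows
    that it is finite.\<close>
  then obtain c where c: "C = ereal c"
    using C(1) by (cases C) (auto simp: S_def)
  obtain \<phi> where \<phi>: "\<And>x y. \<phi> (x + y) = \<phi> x + \<phi> y" "\<And>a x. \<phi> (scale_linf a x) = a * \<phi> x"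
    "\<And>x. norm (\<phi> x) \<le> norm x" "Gf_invariant \<phi>" "norm (\<phi> z) \<ge> c"
    by (rule exists_invariant_functional[OF S, of c z]) (use c in \<open>auto simp: S_def\<close>)
  \<comment> \<open>The functional is contractive, so it stays within 1 on the ball but reaches
    \<open>c > 1\<close> at \<open>z\<close>.\<close>
  have "(SUP w\<in>cball 0 1. ereal (norm (\<phi> w))) \<le> 1"
    using \<phi>(3) by (intro SUP_least) (auto simp: one_ereal_def intro: order_trans)
  also have "1 < ereal c"
    using C(1) c by simp
  also have "ereal c \<le> ereal (norm (\<phi> z))"
    using \<phi>(5) by simp
  finally have "separates \<phi> z (cball 0 1)"
    by (simp add: separates_def)
  then show "\<exists>P. polynomial_linf P \<and> continuous_on UNIV P \<and> Gf_invariant P \<and> separates P z (cball 0 1)"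
    using linear_functional_polynomial_linf[OF \<phi>(1,2)] continuous_on_contractive_additive[OF \<phi>(1,3)] \<phi>(4)
    by blast
qed

end
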